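(* Consider the family of mappings $$f(x,y)=\left(y,\ \frac{\beta_0}{\gamma_0+x}\right),\qquad \beta_0,\gamma_0\in\mathbb{C},\ \beta_0\neq0.$$ Then: (a) If $\gamma_0^2+4\beta_0\neq0$, let $p$ and $q$ be the two different roots of $z^2-\gamma_0z-\beta_0=0$, and let $m$ be such that $m^2=q/p$. Then $f(x,y)$ preserves the generically transverse fibrations $$H_1(x,y)=\frac{m^2p^2+mpx+p(m^2-m+1)y+xy}{(x+p)(y+p)},$$ $$H_2(x,y)=\frac{m^2p^2-mpx+p(m^2+m+1)y+xy}{(x+p)(y+p)},$$ with $H_1(f(x,y))=mH_1(x,y)$ and $H_2(f(x,y))=-mH_2(x,y)$. Furthermore $f(x,y)$ is $2k$-periodic if and only if $m^{2k}=1$, and in this case $H_1^{2k}(x,y)$ and $H_2^{2k}(x,y)$ are two independent first integrals of $f(x,y)$. (b) If $\gamma_0^2+4\beta_0=0$, then $f$ preserves the two generically transverse fibrations $$K_1(x,y)=\frac{\gamma_0^2-2\gamma_0x+6\gamma_0y+4xy}{(2x+\gamma_0)(2y+\gamma_0)},\qquad K_2(x,y)=\frac{2\gamma_0(x+y+\gamma_0)}{(2x+\gamma_0)(2y+\gamma_0)},$$ with $K_1(f(x,y))=-K_1(x,y)$ and $K_2(f(x,y))=K_2(x,y)+1$. Furthermore $f(x,y)$ is integrable, with $W(x,y)=(K_1(x,y))^2$ a first integral.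
   Context: A fibration given by a nonconstant rational function $V$ is preserved by $f$ if $V\circ f=\varphi\circ V$ for some Möbius map $\varphi$; two fibrations are generically transverse if the Jacobian determinant of the pair of functions is not identically zero. A first integral of $f$ is a nonconstant rational function $H$ with $H\circ f=H$; two first integrals are independent if their Jacobian determinant is not identically zero; $f$ is integrable if it has a first integral. Here $k\ge1$ is an integer, and $f$ being $2k$-periodic means that the iterate $f^{2k}$ is the identity. $H_i^{2k}$ denotes the $2k$-th power of the function $H_i$. *)

theory Defs
  imports Complex_Main "HOL-Computational_Algebra.Polynomial_Factorial"
begin

section \<open>The field of rational functions in two variables\<close>

text \<open>
  Rational functions in \<open>x, y\<close> over the complex numbers form the fraction field of
  \<open>\<complex>[x][y]\<close>: the inner polynomial variable is \<open>x\<close>, the outer one is \<open>y\<close>.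
  Equations between rational functions are equations in this field, so no convention about
  values at poles is involved.
\<close>

type_synonym bipoly = "complex poly poly"
type_synonym ratfun = "bipoly fract"
type_synonym ratmap = "ratfun \<times> ratfun"

definition Cst :: "complex \<Rightarrow> ratfun" where
  "Cst c = to_fract [:[:c:]:]"

definition var_x :: ratfun where
  "var_x = to_fract [:[:0, 1:]:]"

definition var_y :: ratfun where
  "var_y = to_fract [:0, 1:]"

definition nonconstant :: "ratfun \<Rightarrow> bool" where
  "nonconstant V \<longleftrightarrow> V \<notin> range Cst"

lemma Cst_0 [simp]: "Cst 0 = 0"
  by (simp add: Cst_def)

lemma Cst_1 [simp]: "Cst 1 = 1"
  by (simp add: Cst_def flip: one_pCons)

lemma Cst_add: "Cst (a + b) = Cst a + Cst b"
  by (simp add: Cst_def flip: to_fract_add)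

lemma Cst_mult: "Cst (a * b) = Cst a * Cst b"
  by (simp add: Cst_def flip: to_fract_mult)


section \<open>Partial derivatives and Jacobian determinant\<close>

text \<open>
  The extension of a derivation \<open>D\<close> to the fraction field; the value does not depend on the
  representation, see \<open>fract_deriv_Fract\<close>.
\<close>

definition fract_deriv :: "('a \<Rightarrow> 'a) \<Rightarrow> 'a :: idom fract \<Rightarrow> 'a fract" where
  "fract_deriv D V =
     (THE R. \<exists>n d. V = Fract n d \<and> d \<noteq> 0 \<and> R = Fract (D n * d - n * D d) (d * d))"

lemma fract_deriv_Fract:
  fixes D :: "'a :: idom \<Rightarrow> 'a"
  assumes D: "\<And>a b. D (a * b) = a * D b + b * D a" and d: "d \<noteq> 0"
  shows "fract_deriv D (Fract n d) = Fract (D n * d - n * D d) (d * d)"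
  unfolding fract_deriv_def
proof (rule the_equality)
  fix R assume "\<exists>n' d'. Fract n d = Fract n' d' \<and> d' \<noteq> 0 \<and> R = Fract (D n' * d' - n' * D d') (d' * d')"
  then obtain n' d' where *: "Fract n d = Fract n' d'" "d' \<noteq> 0"
      "R = Fract (D n' * d' - n' * D d') (d' * d')" by blast
  have eq: "n * d' = n' * d"
    using * d by (simp add: eq_fract)
  then have "D (n * d') = D (n' * d)"
    by simp
  then have deq: "d' * D n = n' * D d + d * D n' - n * D d'"
    by (simp add: D algebra_simps)
  have "(D n * d - n * D d) * (d' * d') = (d' * D n) * d * d' - (n * d') * D d * d'"
    by (simp add: algebra_simps)
  also have "\<dots> = (n' * D d + d * D n' - n * D d') * d * d' - (n' * d) * D d * d'"
    unfolding deq eq ..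
  also have "\<dots> = D n' * d' * d * d - (n * d') * d * D d'"
    by (simp add: algebra_simps)
  also have "\<dots> = (D n' * d' - n' * D d') * (d * d)"
    unfolding eq by (simp add: algebra_simps)
  finally show "R = Fract (D n * d - n * D d) (d * d)"
    using * d by (simp add: eq_fract)
qed (use d in blast)

definition poly_dx :: "bipoly \<Rightarrow> bipoly" where
  "poly_dx = map_poly pderiv"

lemma coeff_poly_dx: "coeff (poly_dx p) i = pderiv (coeff p i)"
  by (simp add: poly_dx_def coeff_map_poly)

lemma poly_dx_add: "poly_dx (p + q) = poly_dx p + poly_dx q"
  by (simp add: poly_eq_iff coeff_poly_dx pderiv_add)

lemma poly_dx_pCons: "poly_dx (pCons a p) = pCons (pderiv a) (poly_dx p)"
  by (simp add: poly_dx_def map_poly_pCons)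

lemma poly_dx_smult: "poly_dx (smult a p) = smult (pderiv a) p + smult a (poly_dx p)"
  by (simp add: poly_eq_iff coeff_poly_dx pderiv_mult mult.commute)

lemma poly_dx_0 [simp]: "poly_dx 0 = 0"
  by (simp add: poly_dx_def)

lemma poly_dx_mult: "poly_dx (p * q) = p * poly_dx q + q * poly_dx p"
  by (induction p) (simp_all add: poly_dx_add poly_dx_pCons poly_dx_smult algebra_simps)

definition ratfun_dx :: "ratfun \<Rightarrow> ratfun" where
  "ratfun_dx = fract_deriv poly_dx"

definition ratfun_dy :: "ratfun \<Rightarrow> ratfun" where
  "ratfun_dy = fract_deriv pderiv"

lemma ratfun_dx_Fract: "d \<noteq> 0 \<Longrightarrow> ratfun_dx (Fract n d) = Fract (poly_dx n * d - n * poly_dx d) (d * d)"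
  by (simp add: ratfun_dx_def fract_deriv_Fract poly_dx_mult)

lemma ratfun_dy_Fract: "d \<noteq> 0 \<Longrightarrow> ratfun_dy (Fract n d) = Fract (pderiv n * d - n * pderiv d) (d * d)"
  by (simp add: ratfun_dy_def fract_deriv_Fract pderiv_mult)

definition jacobian :: "ratfun \<Rightarrow> ratfun \<Rightarrow> ratfun" where
  "jacobian V W = ratfun_dx V * ratfun_dy W - ratfun_dy V * ratfun_dx W"


section \<open>Composition with a rational map\<close>

definition subst_x :: "ratfun \<Rightarrow> complex poly \<Rightarrow> ratfun" where
  "subst_x a p = poly (map_poly Cst p) a"

definition subst :: "bipoly \<Rightarrow> ratmap \<Rightarrow> ratfun" where
  "subst P g = poly (map_poly (subst_x (fst g)) P) (snd g)"

text \<open>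
  The composition \<open>V \<circ> g\<close> is undefined (\<open>None\<close>) exactly when the denominator of every
  representation of \<open>V\<close> as a fraction vanishes identically after substituting \<open>g\<close>.
  Otherwise the value does not depend on the representation, see \<open>rat_comp_Fract\<close>.
\<close>

definition rat_comp :: "ratfun \<Rightarrow> ratmap \<Rightarrow> ratfun option" where
  "rat_comp V g =
     (if \<exists>n d. V = Fract n d \<and> d \<noteq> 0 \<and> subst d g \<noteq> 0
      then Some (THE R. \<exists>n d. V = Fract n d \<and> d \<noteq> 0 \<and> subst d g \<noteq> 0 \<and> R = subst n g / subst d g)
      else None)"

lemma poly_map_poly_hom:
  fixes h :: "'a :: idom \<Rightarrow> 'b :: idom"
  assumes h0: "h 0 = 0" and hadd: "\<And>a b. h (a + b) = h a + h b"
    and hmult: "\<And>a b. h (a * b) = h a * h b"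
  shows "poly (map_poly h (p + q)) b = poly (map_poly h p) b + poly (map_poly h q) b"
    and "poly (map_poly h (p * q)) b = poly (map_poly h p) b * poly (map_poly h q) b"
proof -
  have add: "map_poly h (p + q) = map_poly h p + map_poly h q" for p q
    by (simp add: poly_eq_iff coeff_map_poly h0 hadd)
  have smult: "map_poly h (smult a p) = smult (h a) (map_poly h p)" for a p
    by (simp add: poly_eq_iff coeff_map_poly h0 hmult)
  have "map_poly h (p * q) = map_poly h p * map_poly h q" for p q
    by (induction p) (simp_all add: add smult h0 map_poly_pCons algebra_simps)
  then show "poly (map_poly h (p * q)) b = poly (map_poly h p) b * poly (map_poly h q) b"
    by simp
  show "poly (map_poly h (p + q)) b = poly (map_poly h p) b + poly (map_poly h q) b"
    by (simp add: add)
qed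

lemma subst_x_hom:
  "subst_x a 0 = 0" "subst_x a (p + q) = subst_x a p + subst_x a q"
  "subst_x a (p * q) = subst_x a p * subst_x a q"
  by (simp_all add: subst_x_def poly_map_poly_hom Cst_add Cst_mult)

lemma subst_add: "subst (P + Q) g = subst P g + subst Q g"
  and subst_mult: "subst (P * Q) g = subst P g * subst Q g"
  by (simp_all add: subst_def poly_map_poly_hom subst_x_hom)

lemma rat_comp_Fract:
  assumes "subst d g \<noteq> 0"
  shows "rat_comp (Fract n d) g = Some (subst n g / subst d g)"
proof -
  have d: "d \<noteq> 0"
    using assms by (auto simp: subst_def)
  have "(THE R. \<exists>n' d'. Fract n d = Fract n' d' \<and> d' \<noteq> 0 \<and> subst d' g \<noteq> 0
           \<and> R = subst n' g / subst d' g) = subst n g / subst d g"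
  proof (rule the_equality)
    fix R assume "\<exists>n' d'. Fract n d = Fract n' d' \<and> d' \<noteq> 0 \<and> subst d' g \<noteq> 0
           \<and> R = subst n' g / subst d' g"
    then obtain n' d' where *: "Fract n d = Fract n' d'" "d' \<noteq> 0" "subst d' g \<noteq> 0"
        "R = subst n' g / subst d' g" by blast
    then have "n * d' = n' * d"
      using d by (simp add: eq_fract)
    then have "subst n g * subst d' g = subst n' g * subst d g"
      by (simp flip: subst_mult)
    then show "R = subst n g / subst d g"
      using * assms by (simp add: frac_eq_eq)
  qed (use assms d in blast)
  then show ?thesis
    unfolding rat_comp_def using assms d by auto
qed

definition ratmap_comp :: "ratmap \<Rightarrow> ratmap \<Rightarrow> ratmap option" where
  "ratmap_comp f g =
     (case (rat_comp (fst f) g, rat_comp (snd f) g) of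
        (Some a, Some b) \<Rightarrow> Some (a, b)
      | _ \<Rightarrow> None)"

fun rat_iterate :: "ratmap \<Rightarrow> nat \<Rightarrow> ratmap option" where
  "rat_iterate f 0 = Some (var_x, var_y)"
| "rat_iterate f (Suc n) = Option.bind (rat_iterate f n) (ratmap_comp f)"

definition periodic_map :: "ratmap \<Rightarrow> nat \<Rightarrow> bool" where
  "periodic_map f n \<longleftrightarrow> rat_iterate f n = Some (var_x, var_y)"


section \<open>Fibrations and first integrals\<close>

text \<open>
  Since \<open>V\<close> is nonconstant, the denominator in the Moebius transform of \<open>V\<close> below is nonzero.
\<close>

definition preserves_fibration :: "ratmap \<Rightarrow> ratfun \<Rightarrow> bool" where
  "preserves_fibration f V \<longleftrightarrow> nonconstant V \<and>
     (\<exists>a b c d. a * d - b * c \<noteq> 0 \<and>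
        rat_comp V f = Some ((Cst a * V + Cst b) / (Cst c * V + Cst d)))"

definition generically_transverse :: "ratfun \<Rightarrow> ratfun \<Rightarrow> bool" where
  "generically_transverse V W \<longleftrightarrow> jacobian V W \<noteq> 0"

definition first_integral :: "ratmap \<Rightarrow> ratfun \<Rightarrow> bool" where
  "first_integral f H \<longleftrightarrow> nonconstant H \<and> rat_comp H f = Some H"

definition independent_integrals :: "ratfun \<Rightarrow> ratfun \<Rightarrow> bool" where
  "independent_integrals H K \<longleftrightarrow> jacobian H K \<noteq> 0"

definition integrable_map :: "ratmap \<Rightarrow> bool" where
  "integrable_map f \<longleftrightarrow> (\<exists>H. first_integral f H)"


section \<open>The family of maps and its fibrations\<close>

definition fam :: "complex \<Rightarrow> complex \<Rightarrow> ratmap" where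
  "fam \<beta> \<gamma> = (var_y, Cst \<beta> / (Cst \<gamma> + var_x))"

definition H1 :: "complex \<Rightarrow> complex \<Rightarrow> ratfun" where
  "H1 m p =
     (Cst (m^2 * p^2) + Cst (m * p) * var_x + Cst (p * (m^2 - m + 1)) * var_y + var_x * var_y)
     / ((var_x + Cst p) * (var_y + Cst p))"

definition H2 :: "complex \<Rightarrow> complex \<Rightarrow> ratfun" where
  "H2 m p =
     (Cst (m^2 * p^2) - Cst (m * p) * var_x + Cst (p * (m^2 + m + 1)) * var_y + var_x * var_y)
     / ((var_x + Cst p) * (var_y + Cst p))"

definition K1 :: "complex \<Rightarrow> ratfun" where
  "K1 \<gamma> =
     (Cst (\<gamma>^2) - Cst (2 * \<gamma>) * var_x + Cst (6 * \<gamma>) * var_y + 4 * var_x * var_y)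
     / ((2 * var_x + Cst \<gamma>) * (2 * var_y + Cst \<gamma>))"

definition K2 :: "complex \<Rightarrow> ratfun" where
  "K2 \<gamma> =
     (Cst (2 * \<gamma>) * (var_x + var_y + Cst \<gamma>))
     / ((2 * var_x + Cst \<gamma>) * (2 * var_y + Cst \<gamma>))"

end

theory Submission
  imports Defs
begin

text \<open>
  The family is linear in disguise. Write \<open>p\<close>, \<open>q = m\<^sup>2 p\<close> for the roots of
  \<open>z\<^sup>2 - \<gamma> z - \<beta>\<close>, so that \<open>\<gamma> = p (1 + m\<^sup>2)\<close> and \<open>\<beta> = - m\<^sup>2 p\<^sup>2\<close>. The point \<open>(-p, -p)\<close> is
  fixed, and sending it to infinity by \<open>X = 1 / (x + p)\<close>, \<open>Y = 1 / (y + p)\<close> turns the map into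
  the affine map \<open>(X, Y) \<mapsto> (Y, m\<^sup>2 X + 1 / p)\<close>; this is the content of \<open>rat_comp_chart\<close>
  and \<open>ratmap_comp_fam_chart\<close>. The degenerate case \<open>\<gamma>\<^sup>2 + 4 \<beta> = 0\<close> is the case \<open>m = 1\<close>,
  \<open>p = \<gamma> / 2\<close> of the same computation.

  In these coordinates all four fibrations are of degree one (\<open>H1_eq_affine\<close>, \<open>H2_eq_affine\<close>,
  \<open>K1_eq_affine\<close>, \<open>K2_eq_affine\<close>): \<open>H\<^sub>1\<close> and \<open>H\<^sub>2\<close> are the affine eigenfunctions for the
  eigenvalues \<open>\<plusminus> m\<close> of the linear part, whose square is \<open>m\<^sup>2\<close>. When \<open>m = 1\<close> the map has no
  fixed point in the affine plane; \<open>K\<^sub>1\<close> is an eigenfunction for \<open>-1\<close> and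
  \<open>K\<^sub>2 = p (X + Y)\<close> is translated by \<open>1\<close>. Transversality is the nonvanishing of a
  \<open>2 \<times> 2\<close> determinant, because \<open>X\<close> and \<open>Y\<close> have a nonzero Jacobian determinant.

  The second iterate acts on \<open>X\<close> and on \<open>Y\<close> separately by \<open>z \<mapsto> m\<^sup>2 z + 1 / p\<close>. If
  \<open>m\<^sup>2 \<noteq> 1\<close>, this is a dilation by \<open>m\<^sup>2\<close> about a finite point, so its \<open>k\<close>-th power is
  the identity exactly when \<open>m ^ (2 * k) = 1\<close> (\<open>periodic_iff\<close>). Then the eigenvalues of
  \<open>H\<^sub>1\<close> and \<open>H\<^sub>2\<close> are killed by raising to the power \<open>2 k\<close>, and powers of functions with
  nonzero Jacobian determinant again have nonzero Jacobian determinant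
  (\<open>jacobian_power_nonzero\<close>).
\<close>


section \<open>Constants in the field of rational functions\<close>

lemma Cst_eq_iff [simp]: "Cst a = Cst b \<longleftrightarrow> a = b"
  by (simp add: Cst_def to_fract_eq_iff)

lemma Cst_eq_0_iff [simp]: "Cst a = 0 \<longleftrightarrow> a = 0"
  using Cst_eq_iff[of a 0] by simp

lemma Cst_minus: "Cst (- a) = - Cst a"
  by (metis Cst_0 Cst_add add.right_inverse minus_unique)

lemma Cst_diff: "Cst (a - b) = Cst a - Cst b"
  by (metis Cst_add Cst_minus diff_conv_add_uminus)

lemma Cst_power: "Cst (a ^ n) = Cst a ^ n"
  by (induction n) (simp_all add: Cst_mult)

lemma Cst_inverse: "Cst (inverse a) = inverse (Cst a)"
proof (cases "a = 0")
  case False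
  then have "Cst a * Cst (inverse a) = 1"
    by (simp flip: Cst_mult)
  then show ?thesis
    by (metis inverse_unique)
qed simp

lemma Cst_divide: "Cst (a / b) = Cst a / Cst b"
  by (simp add: divide_inverse Cst_mult Cst_inverse)

lemma Cst_of_nat: "Cst (of_nat n) = of_nat n"
  by (induction n) (simp_all add: Cst_add)

lemma Cst_numeral: "Cst (numeral n) = numeral n"
  using Cst_of_nat[of "numeral n"] by simp

lemmas Cst_hom = Cst_add Cst_diff Cst_minus Cst_mult Cst_power Cst_divide Cst_numeral

lemma numeral_ratfun_nonzero [simp]: "(numeral n :: ratfun) \<noteq> 0"
  by (simp flip: Cst_numeral)

lemma var_x_plus_Cst_nonzero [simp]: "var_x + Cst c \<noteq> 0"
  by (simp add: var_x_def Cst_def flip: to_fract_add)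

lemma var_y_plus_Cst_nonzero [simp]: "var_y + Cst c \<noteq> 0"
  by (simp add: var_y_def Cst_def flip: to_fract_add)


section \<open>Composition is a partial field homomorphism\<close>

lemma rat_comp_eq_SomeE:
  assumes "rat_comp V g = Some A"
  obtains n d where "V = Fract n d" "d \<noteq> 0" "subst d g \<noteq> 0" "A = subst n g / subst d g"
proof -
  have "\<exists>n d. V = Fract n d \<and> d \<noteq> 0 \<and> subst d g \<noteq> 0"
    using assms unfolding rat_comp_def by (meson option.distinct(1))
  then obtain n d where nd: "V = Fract n d" "d \<noteq> 0" "subst d g \<noteq> 0"
    by blast
  with assms have "A = subst n g / subst d g"
    by (simp add: rat_comp_Fract)
  with nd that show thesis
    by blast
qed

lemma subst_1 [simp]: "subst 1 g = 1"
  by (simp add: subst_def subst_x_def map_poly_pCons one_pCons subst_x_hom)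

lemma rat_comp_to_fract: "rat_comp (to_fract P) g = Some (subst P g)"
  using rat_comp_Fract[of 1 g P] by (simp add: to_fract_def)

lemma rat_comp_Cst: "rat_comp (Cst c) g = Some (Cst c)"
  unfolding Cst_def[of c] rat_comp_to_fract
  by (simp add: subst_def subst_x_def map_poly_pCons subst_x_hom flip: Cst_def)

lemma rat_comp_var_x: "rat_comp var_x g = Some (fst g)"
  by (simp add: var_x_def rat_comp_to_fract)
    (simp add: subst_def subst_x_def map_poly_pCons subst_x_hom)

lemma rat_comp_var_y: "rat_comp var_y g = Some (snd g)"
  by (simp add: var_y_def rat_comp_to_fract)
    (simp add: subst_def subst_x_def map_poly_pCons subst_x_hom)

lemma rat_comp_add:
  assumes "rat_comp V g = Some A" "rat_comp W g = Some B"
  shows "rat_comp (V + W) g = Some (A + B)"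
proof -
  from assms(1) obtain n d where 1: "V = Fract n d" "d \<noteq> 0" "subst d g \<noteq> 0" "A = subst n g / subst d g"
    by (rule rat_comp_eq_SomeE)
  from assms(2) obtain n' d' where 2: "W = Fract n' d'" "d' \<noteq> 0" "subst d' g \<noteq> 0" "B = subst n' g / subst d' g"
    by (rule rat_comp_eq_SomeE)
  show ?thesis
    using 1 2 by (simp add: rat_comp_Fract subst_mult subst_add add_frac_eq)
qed

lemma rat_comp_mult:
  assumes "rat_comp V g = Some A" "rat_comp W g = Some B"
  shows "rat_comp (V * W) g = Some (A * B)"
proof -
  from assms(1) obtain n d where 1: "V = Fract n d" "d \<noteq> 0" "subst d g \<noteq> 0" "A = subst n g / subst d g"
    by (rule rat_comp_eq_SomeE)
  from assms(2) obtain n' d' where 2: "W = Fract n' d'" "d' \<noteq> 0" "subst d' g \<noteq> 0" "B = subst n' g / subst d' g"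
    by (rule rat_comp_eq_SomeE)
  show ?thesis
    using 1 2 by (simp add: rat_comp_Fract subst_mult)
qed

lemma rat_comp_inverse:
  assumes "rat_comp V g = Some A" "A \<noteq> 0"
  shows "rat_comp (inverse V) g = Some (inverse A)"
proof -
  from assms(1) obtain n d where 1: "V = Fract n d" "d \<noteq> 0" "subst d g \<noteq> 0" "A = subst n g / subst d g"
    by (rule rat_comp_eq_SomeE)
  show ?thesis
    using 1 assms(2) by (simp add: rat_comp_Fract)
qed

lemma rat_comp_power:
  assumes "rat_comp V g = Some A"
  shows "rat_comp (V ^ n) g = Some (A ^ n)"
proof (induction n)
  case 0
  show ?case
    using rat_comp_Cst[of 1] by simp
qed (simp add: rat_comp_mult assms)


section \<open>Derivations and the Jacobian determinant\<close>

lemma fract_deriv_add: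
  assumes D: "\<And>a b. D (a * b) = a * D b + b * D a" and add: "\<And>a b. D (a + b) = D a + D b"
  shows "fract_deriv D (V + W) = fract_deriv D V + fract_deriv D W"
proof -
  obtain n d where V: "V = Fract n d" "d \<noteq> 0"
    by (cases V) auto
  obtain n' d' where W: "W = Fract n' d'" "d' \<noteq> 0"
    by (cases W) auto
  show ?thesis
    using V W by (simp add: fract_deriv_Fract[OF D] D add eq_fract algebra_simps)
qed

lemma fract_deriv_mult:
  assumes D: "\<And>a b. D (a * b) = a * D b + b * D a"
  shows "fract_deriv D (V * W) = V * fract_deriv D W + W * fract_deriv D V"
proof -
  obtain n d where V: "V = Fract n d" "d \<noteq> 0"
    by (cases V) auto
  obtain n' d' where W: "W = Fract n' d'" "d' \<noteq> 0"
    by (cases W) auto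
  show ?thesis
    using V W by (simp add: fract_deriv_Fract[OF D] D eq_fract algebra_simps)
qed

lemma ratfun_dx_add: "ratfun_dx (V + W) = ratfun_dx V + ratfun_dx W"
  and ratfun_dy_add: "ratfun_dy (V + W) = ratfun_dy V + ratfun_dy W"
  and ratfun_dx_mult: "ratfun_dx (V * W) = V * ratfun_dx W + W * ratfun_dx V"
  and ratfun_dy_mult: "ratfun_dy (V * W) = V * ratfun_dy W + W * ratfun_dy V"
  unfolding ratfun_dx_def ratfun_dy_def
  by (rule fract_deriv_add fract_deriv_mult;
      simp add: poly_dx_mult pderiv_mult poly_dx_add pderiv_add)+

lemma poly_dx_1 [simp]: "poly_dx 1 = 0"
  by (simp add: poly_dx_def map_poly_1)

lemma ratfun_d_to_fract:
  "ratfun_dx (to_fract P) = to_fract (poly_dx P)" "ratfun_dy (to_fract P) = to_fract (pderiv P)"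
  by (simp_all add: to_fract_def ratfun_dx_Fract ratfun_dy_Fract)

lemma ratfun_d_Cst [simp]: "ratfun_dx (Cst c) = 0" "ratfun_dy (Cst c) = 0"
  by (simp_all add: Cst_def ratfun_d_to_fract poly_dx_pCons)

lemma ratfun_d_var [simp]:
  "ratfun_dx var_x = 1" "ratfun_dy var_x = 0" "ratfun_dx var_y = 0" "ratfun_dy var_y = 1"
  by (simp_all add: var_x_def var_y_def ratfun_d_to_fract poly_dx_pCons pderiv_pCons flip: one_pCons)

text \<open>
  Both partial derivatives obey the Leibniz rule, so the rules for inverses and powers are
  proved once, for any such operator.
\<close>

lemma leibniz_inverse:
  fixes d :: "'a :: field \<Rightarrow> 'a"
  assumes d: "\<And>a b. d (a * b) = a * d b + b * d a" and "V \<noteq> 0"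
  shows "d (inverse V) = - d V * inverse V ^ 2"
proof -
  have "d 1 = 0"
    using d[of 1 1] by (metis add_cancel_right_right mult_1)
  then have "V * d (inverse V) + inverse V * d V = 0"
    using d[of V "inverse V"] \<open>V \<noteq> 0\<close> by simp
  then have "V * d (inverse V) = - (inverse V * d V)"
    by (simp add: eq_neg_iff_add_eq_0)
  then have "inverse V * (V * d (inverse V)) = inverse V * - (inverse V * d V)"
    by simp
  then show ?thesis
    using \<open>V \<noteq> 0\<close> by (simp add: power2_eq_square mult.assoc[symmetric])
qed

lemma leibniz_power:
  fixes d :: "'a :: field \<Rightarrow> 'a"
  assumes d: "\<And>a b. d (a * b) = a * d b + b * d a"
  shows "d (V ^ Suc n) = of_nat (Suc n) * V ^ n * d V"
  by (induction n) (simp_all add: d algebra_simps)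

lemma jacobian_const [simp]: "jacobian (Cst c) W = 0" "jacobian V (Cst c) = 0"
  by (simp_all add: jacobian_def)

lemma nonconstant_if_jacobian_nonzero:
  assumes "jacobian V W \<noteq> 0"
  shows "nonconstant V" "nonconstant W"
  using assms by (auto simp: nonconstant_def)

lemma nonconstant_affine_nonzero:
  assumes "nonconstant V" "r \<noteq> 0"
  shows "Cst r * V + Cst c \<noteq> 0"
proof
  assume "Cst r * V + Cst c = 0"
  then have "V = Cst (- c / r)"
    using \<open>r \<noteq> 0\<close> by (simp add: Cst_hom field_simps eq_neg_iff_add_eq_0)
  then show False
    using \<open>nonconstant V\<close> by (auto simp: nonconstant_def)
qed

lemma nonconstant_nonzero: "nonconstant V \<Longrightarrow> V \<noteq> 0"
  using nonconstant_affine_nonzero[of V 1 0] by simp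

text \<open>
  By the chain rule the Jacobian determinant of two powers is
  \<open>n l V\<^bsup>n-1\<^esup> W\<^bsup>l-1\<^esup>\<close> times that of \<open>V\<close> and \<open>W\<close>; the extra factor is nonzero because
  the characteristic is zero and neither \<open>V\<close> nor \<open>W\<close> is constant.
\<close>

lemma jacobian_power_nonzero:
  assumes J: "jacobian V W \<noteq> 0" and "n > 0" "l > 0"
  shows "jacobian (V ^ n) (W ^ l) \<noteq> 0"
proof -
  obtain i j where ij: "n = Suc i" "l = Suc j"
    using assms by (metis gr0_conv_Suc)
  have "jacobian (V ^ n) (W ^ l) = of_nat n * V ^ i * (of_nat l * W ^ j) * jacobian V W"
    unfolding ij jacobian_def leibniz_power[where d = ratfun_dx, OF ratfun_dx_mult]
      leibniz_power[where d = ratfun_dy, OF ratfun_dy_mult]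
    by (simp add: algebra_simps)
  moreover have "(of_nat n :: ratfun) \<noteq> 0" "(of_nat l :: ratfun) \<noteq> 0"
    using assms by (simp_all flip: Cst_of_nat)
  ultimately show ?thesis
    using J nonconstant_if_jacobian_nonzero[OF J, THEN nonconstant_nonzero] by simp
qed


section \<open>The linearising coordinates\<close>

definition chart_x :: "complex \<Rightarrow> ratfun" where
  "chart_x p = inverse (var_x + Cst p)"

definition chart_y :: "complex \<Rightarrow> ratfun" where
  "chart_y p = inverse (var_y + Cst p)"

text \<open>
  Polynomials of degree at most one in the chart, indexed by their coefficients, so that
  statements about the fibrations become identities between complex numbers.
\<close>

definition affine :: "complex \<Rightarrow> complex \<Rightarrow> complex \<Rightarrow> complex \<Rightarrow> ratfun" where
  "affine p a b c = Cst a * chart_x p + Cst b * chart_y p + Cst c"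

lemma chart_nonzero [simp]: "chart_x p \<noteq> 0" "chart_y p \<noteq> 0"
  by (simp_all add: chart_x_def chart_y_def)

lemma ratfun_d_chart:
  "ratfun_dx (chart_x p) = - (chart_x p ^ 2)" "ratfun_dy (chart_x p) = 0"
  "ratfun_dx (chart_y p) = 0" "ratfun_dy (chart_y p) = - (chart_y p ^ 2)"
  by (simp_all add: chart_x_def chart_y_def ratfun_dx_add ratfun_dy_add
      leibniz_inverse[where d = ratfun_dx, OF ratfun_dx_mult]
      leibniz_inverse[where d = ratfun_dy, OF ratfun_dy_mult])

lemma jacobian_affine:
  "jacobian (affine p a b c) (affine p a' b' c') =
     Cst (a * b' - b * a') * (chart_x p ^ 2 * chart_y p ^ 2)"
  by (simp add: jacobian_def affine_def ratfun_dx_add ratfun_dy_add ratfun_dx_mult ratfun_dy_mult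
      ratfun_d_chart Cst_hom algebra_simps)

lemma jacobian_affine_nonzero:
  "jacobian (affine p a b c) (affine p a' b' c') \<noteq> 0 \<longleftrightarrow> a * b' \<noteq> b * a'"
  by (simp add: jacobian_affine)

lemma nonconstant_chart: "nonconstant (chart_x p)" "nonconstant (chart_y p)"
proof -
  have "jacobian (chart_x p) (chart_y p) \<noteq> 0"
    using jacobian_affine_nonzero[of p 1 0 0 0 1 0] by (simp add: affine_def)
  then show "nonconstant (chart_x p)" "nonconstant (chart_y p)"
    by (rule nonconstant_if_jacobian_nonzero)+
qed

lemma Cst_mult_affine: "Cst r * affine p a b c = affine p (r * a) (r * b) (r * c)"
  by (simp add: affine_def Cst_hom algebra_simps)

lemma affine_plus_1: "affine p a b c + 1 = affine p a b (c + 1)"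
  by (simp add: affine_def Cst_hom)

lemma var_x_eq_chart: "var_x = inverse (chart_x p) - Cst p"
  and var_y_eq_chart: "var_y = inverse (chart_y p) - Cst p"
  by (simp_all add: chart_x_def chart_y_def)

text \<open>
  The map in the chart, at an arbitrary pair \<open>(1 / U - p, 1 / V - p)\<close> of rational functions. It
  rests on \<open>\<gamma> + x = p m\<^sup>2 + 1 / U\<close> and
  \<open>p + \<beta> / (\<gamma> + x) = p (x + p) / (\<gamma> + x)\<close>.
\<close>

lemma ratmap_comp_fam_chart:
  assumes "p \<noteq> 0" "U \<noteq> 0" "Cst (m^2) * U + Cst (1 / p) \<noteq> 0"
  shows "ratmap_comp (fam (- (m^2 * p^2)) (p * (1 + m^2))) (inverse U - Cst p, inverse V - Cst p) =
    Some (inverse V - Cst p, inverse (Cst (m^2) * U + Cst (1 / p)) - Cst p)"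
proof -
  let ?g = "(inverse U - Cst p, inverse V - Cst p)"
  define w where "w = Cst (m^2) * U + Cst (1 / p)"
  have "Cst p * Cst (1 / p) = 1"
    using \<open>p \<noteq> 0\<close> by (simp flip: Cst_mult)
  then have w: "w \<noteq> 0" "Cst p * w = Cst p * Cst (m^2) * U + 1"
    using assms(3) by (simp_all add: w_def distrib_left mult.assoc)
  have den: "Cst (p * (1 + m^2)) + (inverse U - Cst p) = Cst p * w / U"
    unfolding w(2) using \<open>U \<noteq> 0\<close> by (simp add: Cst_hom field_simps)
  have nz: "Cst p * w / U \<noteq> 0"
    using assms(1,2) w(1) by simp
  have "rat_comp (Cst (p * (1 + m^2)) + var_x) ?g = Some (Cst p * w / U)"
    using rat_comp_add[OF rat_comp_Cst rat_comp_var_x, of "p * (1 + m^2)" ?g] den by simp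
  then have "rat_comp (Cst (- (m^2 * p^2)) / (Cst (p * (1 + m^2)) + var_x)) ?g
      = Some (Cst (- (m^2 * p^2)) * inverse (Cst p * w / U))"
    unfolding divide_inverse
    by (intro rat_comp_mult rat_comp_Cst rat_comp_inverse)
      (use nz in \<open>simp_all add: divide_inverse\<close>)
  moreover have "Cst (- (m^2 * p^2)) * inverse (Cst p * w / U) = inverse w - Cst p"
  proof -
    have "Cst (- (m^2 * p^2)) * inverse (Cst p * w / U) = - Cst p * Cst (m^2) * U / w"
      using assms w(1) by (simp add: Cst_hom field_simps power2_eq_square)
    also have "\<dots> = (1 - Cst p * w) / w"
      by (simp add: w(2))
    also have "\<dots> = inverse w - Cst p"
      using w(1) by (simp add: field_simps)
    finally show ?thesis .
  qed
  ultimately show ?thesis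
    by (simp add: ratmap_comp_def fam_def rat_comp_var_y w_def)
qed

text \<open>
  This is the previous lemma at the identity map, which is the pair \<open>U = X\<close>, \<open>V = Y\<close>.
\<close>

lemma fam_eq_chart:
  assumes "p \<noteq> 0" "m \<noteq> 0"
  shows "fam (- (m^2 * p^2)) (p * (1 + m^2)) =
    (inverse (chart_y p) - Cst p, inverse (Cst (m^2) * chart_x p + Cst (1 / p)) - Cst p)"
proof -
  let ?f = "fam (- (m^2 * p^2)) (p * (1 + m^2))"
  have "Cst (m^2) * chart_x p + Cst (1 / p) \<noteq> 0"
    using assms by (intro nonconstant_affine_nonzero nonconstant_chart) simp
  then have "ratmap_comp ?f (var_x, var_y) =
      Some (inverse (chart_y p) - Cst p, inverse (Cst (m^2) * chart_x p + Cst (1 / p)) - Cst p)"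
    using ratmap_comp_fam_chart[of p "chart_x p" m "chart_y p"] assms
    by (simp flip: var_x_eq_chart var_y_eq_chart)
  moreover have "ratmap_comp ?f (var_x, var_y) = Some ?f"
  proof -
    have "Cst (p * (1 + m^2)) + var_x \<noteq> 0"
      using var_x_plus_Cst_nonzero by (simp add: add.commute)
    then have "rat_comp (Cst (- (m^2 * p^2)) / (Cst (p * (1 + m^2)) + var_x)) (var_x, var_y)
        = Some (Cst (- (m^2 * p^2)) / (Cst (p * (1 + m^2)) + var_x))"
      unfolding divide_inverse
      using rat_comp_add[OF rat_comp_Cst rat_comp_var_x, of "p * (1 + m^2)" "(var_x, var_y)"]
      by (intro rat_comp_mult rat_comp_Cst rat_comp_inverse) simp_all
    then show ?thesis
      by (simp add: ratmap_comp_def fam_def rat_comp_var_y)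
  qed
  ultimately show ?thesis
    by simp
qed

lemma rat_comp_chart:
  assumes "p \<noteq> 0" "m \<noteq> 0"
  defines "f \<equiv> fam (- (m^2 * p^2)) (p * (1 + m^2))"
  shows "rat_comp (chart_x p) f = Some (chart_y p)"
    and "rat_comp (chart_y p) f = Some (Cst (m^2) * chart_x p + Cst (1 / p))"
proof -
  have f: "f = (inverse (chart_y p) - Cst p, inverse (Cst (m^2) * chart_x p + Cst (1 / p)) - Cst p)"
    unfolding f_def by (rule fam_eq_chart) fact+
  have nz: "Cst (m^2) * chart_x p + Cst (1 / p) \<noteq> 0"
    using assms(1,2) by (intro nonconstant_affine_nonzero nonconstant_chart) simp
  have "rat_comp (var_x + Cst p) f = Some (inverse (chart_y p))"
    using rat_comp_add[OF rat_comp_var_x[of f] rat_comp_Cst[of p]] by (simp add: f)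
  from rat_comp_inverse[OF this] show "rat_comp (chart_x p) f = Some (chart_y p)"
    by (simp add: chart_x_def)
  have "rat_comp (var_y + Cst p) f = Some (inverse (Cst (m^2) * chart_x p + Cst (1 / p)))"
    using rat_comp_add[OF rat_comp_var_y[of f] rat_comp_Cst[of p]] by (simp add: f)
  from rat_comp_inverse[OF this] nz
  show "rat_comp (chart_y p) f = Some (Cst (m^2) * chart_x p + Cst (1 / p))"
    by (simp add: chart_y_def)
qed

lemma rat_comp_affine:
  assumes "p \<noteq> 0" "m \<noteq> 0"
  shows "rat_comp (affine p a b c) (fam (- (m^2 * p^2)) (p * (1 + m^2))) =
    Some (affine p (b * m^2) a (c + b / p))"
proof -
  have "rat_comp (affine p a b c) (fam (- (m^2 * p^2)) (p * (1 + m^2))) =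
      Some (Cst a * chart_y p + Cst b * (Cst (m^2) * chart_x p + Cst (1 / p)) + Cst c)"
    unfolding affine_def
    by (intro rat_comp_add rat_comp_mult rat_comp_Cst rat_comp_chart assms)
  then show ?thesis
    by (simp add: affine_def Cst_hom algebra_simps)
qed


section \<open>Periodicity\<close>

text \<open>
  The constant term is that of the \<open>k\<close>-th power of \<open>z \<mapsto> m\<^sup>2 z + 1 / p\<close>, a geometric sum.
  The iterates never run into a vanishing denominator because the functions involved are
  nonconstant affine functions of one chart coordinate.
\<close>

lemma rat_iterate_fam_even:
  assumes "p \<noteq> 0" "m \<noteq> 0" "m^2 \<noteq> 1"
  defines "c \<equiv> \<lambda>k. (m ^ (2 * k) - 1) / (p * (m^2 - 1))"
  shows "rat_iterate (fam (- (m^2 * p^2)) (p * (1 + m^2))) (2 * k) =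
    Some (inverse (Cst (m ^ (2 * k)) * chart_x p + Cst (c k)) - Cst p,
          inverse (Cst (m ^ (2 * k)) * chart_y p + Cst (c k)) - Cst p)"
proof (induction k)
  case 0
  show ?case
    by (simp add: c_def flip: var_x_eq_chart var_y_eq_chart)
next
  case (Suc k)
  let ?U = "\<lambda>k. Cst (m ^ (2 * k)) * chart_x p + Cst (c k)"
  let ?V = "\<lambda>k. Cst (m ^ (2 * k)) * chart_y p + Cst (c k)"
  have nz: "?U k \<noteq> 0" "?V k \<noteq> 0" for k
    using \<open>m \<noteq> 0\<close> by (simp_all add: nonconstant_affine_nonzero nonconstant_chart)
  have "c (Suc k) = m^2 * c k + 1 / p"
    using assms(1,3) by (simp add: c_def divide_simps) (simp add: algebra_simps power2_eq_square)
  then have step: "Cst (m^2) * ?U k + Cst (1 / p) = ?U (Suc k)"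
      "Cst (m^2) * ?V k + Cst (1 / p) = ?V (Suc k)"
    by (simp_all add: Cst_add Cst_mult algebra_simps power2_eq_square)
  have "ratmap_comp (fam (- (m^2 * p^2)) (p * (1 + m^2))) (inverse (?U k) - Cst p, inverse (?V k) - Cst p)
      = Some (inverse (?V k) - Cst p, inverse (?U (Suc k)) - Cst p)"
    using ratmap_comp_fam_chart[OF \<open>p \<noteq> 0\<close>, of "?U k" m "?V k"] nz unfolding step by blast
  moreover have "ratmap_comp (fam (- (m^2 * p^2)) (p * (1 + m^2))) (inverse (?V k) - Cst p, inverse (?U (Suc k)) - Cst p)
      = Some (inverse (?U (Suc k)) - Cst p, inverse (?V (Suc k)) - Cst p)"
    using ratmap_comp_fam_chart[OF \<open>p \<noteq> 0\<close>, of "?V k" m "?U (Suc k)"] nz unfolding step by blast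
  moreover have "2 * Suc k = Suc (Suc (2 * k))"
    by simp
  ultimately show ?case
    using Suc.IH by (metis rat_iterate.simps(2) bind.bind_lunit)
qed

text \<open>
  If the iterate is the identity, its first component gives
  \<open>(m\<^bsup>2k\<^esup> - 1) (X + 1 / (p (m\<^sup>2 - 1))) = 0\<close>, and \<open>X\<close> is not constant.
\<close>

lemma periodic_iff:
  assumes "p \<noteq> 0" "m \<noteq> 0" "m^2 \<noteq> 1"
  shows "periodic_map (fam (- (m^2 * p^2)) (p * (1 + m^2))) (2 * k) \<longleftrightarrow> m ^ (2 * k) = 1"
proof
  define c where "c = (m ^ (2 * k) - 1) / (p * (m^2 - 1))"
  assume "periodic_map (fam (- (m^2 * p^2)) (p * (1 + m^2))) (2 * k)"
  then have "inverse (Cst (m ^ (2 * k)) * chart_x p + Cst c) - Cst p = inverse (chart_x p) - Cst p"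
    using rat_iterate_fam_even[OF assms, of k] by (simp add: periodic_map_def c_def flip: var_x_eq_chart)
  then have eq: "Cst (m ^ (2 * k) - 1) * chart_x p + Cst c = 0"
    by (simp add: Cst_diff algebra_simps)
  show "m ^ (2 * k) = 1"
    using nonconstant_affine_nonzero[OF nonconstant_chart(1) _, of "m ^ (2 * k) - 1" p c] eq by auto
next
  assume "m ^ (2 * k) = 1"
  then show "periodic_map (fam (- (m^2 * p^2)) (p * (1 + m^2))) (2 * k)"
    using rat_iterate_fam_even[OF assms, of k]
    by (simp add: periodic_map_def flip: var_x_eq_chart var_y_eq_chart)
qed


section \<open>The fibrations\<close>

lemma affine_eq_fraction:
  "affine p a b c =
     (Cst a * (var_y + Cst p) + Cst b * (var_x + Cst p) + Cst c * ((var_x + Cst p) * (var_y + Cst p)))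
     / ((var_x + Cst p) * (var_y + Cst p))"
proof -
  have "u * inverse s + v * inverse t + w = (u * t + v * s + w * (s * t)) / (s * t)"
    if "s \<noteq> 0" "t \<noteq> 0" for u v w s t :: ratfun
    using that by (simp add: field_simps)
  then show ?thesis
    by (simp add: affine_def chart_x_def chart_y_def)
qed

text \<open>
  The identities below are partial fraction expansions at the lines \<open>x = -p\<close> and \<open>y = -p\<close>;
  the absence of an \<open>X Y\<close> term means that the numerator vanishes at the fixed point
  \<open>(-p, -p)\<close>.
\<close>

lemma H1_eq_affine: "H1 m p = affine p (p * m * (m - 1)) (p * (m - 1)) 1"
  unfolding H1_def affine_eq_fraction
  by (rule arg_cong2[where f = "(/)"]) (simp_all add: Cst_hom algebra_simps power2_eq_square)

lemma H2_eq_affine: "H2 m p = affine p (p * m * (m + 1)) (- (p * (m + 1))) 1"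
proof -
  have "H2 m p = H1 (- m) p"
    by (simp add: H1_def H2_def Cst_minus)
  moreover have "p * (- m) * (- m - 1) = p * m * (m + 1)" "p * (- m - 1) = - (p * (m + 1))"
    by (simp_all add: algebra_simps)
  ultimately show ?thesis
    by (simp only: H1_eq_affine)
qed

lemma K1_eq_affine: "K1 (2 * p) = affine p (2 * p) (- (2 * p)) 1"
  and K2_eq_affine: "K2 (2 * p) = affine p p p 0"
proof -
  let ?D = "(var_x + Cst p) * (var_y + Cst p)"
  have den: "(2 * var_x + Cst (2 * p)) * (2 * var_y + Cst (2 * p)) = 4 * ?D"
    by (simp add: Cst_hom algebra_simps)
  have cancel: "N / (4 * ?D) = N' / ?D" if "N = 4 * N'" for N N' :: ratfun
    unfolding that by (rule mult_divide_mult_cancel_left) simp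
  show "K1 (2 * p) = affine p (2 * p) (- (2 * p)) 1"
    unfolding K1_def affine_eq_fraction den
    by (rule cancel) (simp add: Cst_hom algebra_simps power2_eq_square)
  show "K2 (2 * p) = affine p p p 0"
    unfolding K2_def affine_eq_fraction den
    by (rule cancel) (simp add: Cst_hom algebra_simps power2_eq_square)
qed

lemma preserves_fibration_affineI:
  assumes "nonconstant V" "rat_comp V f = Some (Cst a * V + Cst b)" "a \<noteq> 0"
  shows "preserves_fibration f V"
proof -
  have "a * 1 - b * 0 \<noteq> 0" "rat_comp V f = Some ((Cst a * V + Cst b) / (Cst 0 * V + Cst 1))"
    using assms by simp_all
  then show ?thesis
    unfolding preserves_fibration_def using assms(1) by blast
qed

lemma rat_comp_eigen_power:
  assumes "rat_comp H f = Some (Cst r * H)" "r ^ n = 1"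
  shows "rat_comp (H ^ n) f = Some (H ^ n)"
  using rat_comp_power[OF assms(1), of n] assms(2) by (simp add: power_mult_distrib flip: Cst_power)

theorem proposition13:
  fixes \<beta> \<gamma> :: complex
  assumes "\<beta> \<noteq> 0"
  shows
    "(\<gamma>^2 + 4 * \<beta> \<noteq> 0 \<longrightarrow>
       (\<forall>p q m. p \<noteq> q \<and> p^2 - \<gamma> * p - \<beta> = 0 \<and> q^2 - \<gamma> * q - \<beta> = 0 \<and> m^2 = q / p \<longrightarrow>
          preserves_fibration (fam \<beta> \<gamma>) (H1 m p) \<and>
          preserves_fibration (fam \<beta> \<gamma>) (H2 m p) \<and>
          generically_transverse (H1 m p) (H2 m p) \<and>
          rat_comp (H1 m p) (fam \<beta> \<gamma>) = Some (Cst m * H1 m p) \<and>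
          rat_comp (H2 m p) (fam \<beta> \<gamma>) = Some (- Cst m * H2 m p) \<and>
          (\<forall>k\<ge>1.
             (periodic_map (fam \<beta> \<gamma>) (2 * k) \<longleftrightarrow> m ^ (2 * k) = 1) \<and>
             (m ^ (2 * k) = 1 \<longrightarrow>
                first_integral (fam \<beta> \<gamma>) (H1 m p ^ (2 * k)) \<and>
                first_integral (fam \<beta> \<gamma>) (H2 m p ^ (2 * k)) \<and>
                independent_integrals (H1 m p ^ (2 * k)) (H2 m p ^ (2 * k))))))
     \<and>
     (\<gamma>^2 + 4 * \<beta> = 0 \<longrightarrow>
        preserves_fibration (fam \<beta> \<gamma>) (K1 \<gamma>) \<and>
        preserves_fibration (fam \<beta> \<gamma>) (K2 \<gamma>) \<and>
        generically_transverse (K1 \<gamma>) (K2 \<gamma>) \<and>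
        rat_comp (K1 \<gamma>) (fam \<beta> \<gamma>) = Some (- K1 \<gamma>) \<and>
        rat_comp (K2 \<gamma>) (fam \<beta> \<gamma>) = Some (K2 \<gamma> + 1) \<and>
        integrable_map (fam \<beta> \<gamma>) \<and>
        first_integral (fam \<beta> \<gamma>) ((K1 \<gamma>)^2))"
proof (intro conjI[OF impI impI] allI impI, goal_cases)
  case (1 p q m)
  then have pq: "p \<noteq> q" "p^2 - \<gamma> * p - \<beta> = 0" "q^2 - \<gamma> * q - \<beta> = 0" "m^2 = q / p"
    by blast+
  have "p \<noteq> 0" "q \<noteq> 0"
    using pq assms by auto
  then have q: "q = m^2 * p" and m: "m \<noteq> 0" "m^2 \<noteq> 1"
    using pq by auto
  \<comment> \<open>Vieta's formulas; they need the roots to be different.\<close>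
  have "(p - q) * (p + q - \<gamma>) = 0"
    using pq(2,3) by algebra
  then have "p + q = \<gamma>"
    using pq(1) by simp
  then have "\<gamma> = p * (1 + m^2)"
    using q by (simp add: algebra_simps)
  moreover from this have "\<beta> = - (m^2 * p^2)"
    using pq(2) by algebra
  ultimately have f: "fam \<beta> \<gamma> = fam (- (m^2 * p^2)) (p * (1 + m^2))" (is "_ = ?f")
    by simp
  have H1: "rat_comp (H1 m p) ?f = Some (Cst m * H1 m p)"
    by (simp only: H1_eq_affine rat_comp_affine[OF \<open>p \<noteq> 0\<close> m(1)] Cst_mult_affine)
      (use \<open>p \<noteq> 0\<close> in \<open>simp add: power2_eq_square algebra_simps diff_divide_distrib\<close>)
  have H2: "rat_comp (H2 m p) ?f = Some (Cst (- m) * H2 m p)"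
    by (simp only: H2_eq_affine rat_comp_affine[OF \<open>p \<noteq> 0\<close> m(1)] Cst_mult_affine)
      (use \<open>p \<noteq> 0\<close> in \<open>simp add: power2_eq_square algebra_simps diff_divide_distrib\<close>)
  have det: "(p * m * (m - 1)) * (- (p * (m + 1))) - (p * (m - 1)) * (p * m * (m + 1))
      = - 2 * p^2 * m * (m^2 - 1)"
    by (simp add: algebra_simps power2_eq_square)
  have J: "jacobian (H1 m p) (H2 m p) \<noteq> 0"
    unfolding H1_eq_affine H2_eq_affine jacobian_affine det using \<open>p \<noteq> 0\<close> m by simp
  note nonconst = nonconstant_if_jacobian_nonzero[OF J]
  have "preserves_fibration ?f (H1 m p)" "preserves_fibration ?f (H2 m p)"
    using nonconst H1 H2 m(1)
      preserves_fibration_affineI[of "H1 m p" ?f m 0] preserves_fibration_affineI[of "H2 m p" ?f "- m" 0]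
    by simp_all
  moreover have "first_integral ?f (H1 m p ^ (2 * k)) \<and> first_integral ?f (H2 m p ^ (2 * k))
      \<and> independent_integrals (H1 m p ^ (2 * k)) (H2 m p ^ (2 * k))"
    if "k \<ge> 1" "m ^ (2 * k) = 1" for k
  proof -
    have Jk: "jacobian (H1 m p ^ (2 * k)) (H2 m p ^ (2 * k)) \<noteq> 0"
      using J that(1) by (intro jacobian_power_nonzero) simp_all
    show ?thesis
      using Jk nonconstant_if_jacobian_nonzero[OF Jk] that(2)
        rat_comp_eigen_power[OF H1] rat_comp_eigen_power[OF H2]
      by (simp add: first_integral_def independent_integrals_def)
  qed
  ultimately show ?case
    unfolding f
    using H1 H2 J periodic_iff[OF \<open>p \<noteq> 0\<close> m]
    by (simp add: generically_transverse_def Cst_minus)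
next
  case 2
  define p where "p = \<gamma> / 2"
  have \<gamma>: "\<gamma> = 2 * p"
    by (simp add: p_def)
  have \<beta>: "\<beta> = - (p^2)"
    using 2 unfolding \<gamma> by algebra
  have "p \<noteq> 0"
    using assms \<beta> by auto
  have aff: "rat_comp (affine p a b c) (fam \<beta> \<gamma>) = Some (affine p b a (c + b / p))" for a b c
    using rat_comp_affine[of p 1 a b c] \<open>p \<noteq> 0\<close> by (simp add: \<beta> \<gamma> mult.commute)
  have K1: "rat_comp (K1 \<gamma>) (fam \<beta> \<gamma>) = Some (Cst (- 1) * K1 \<gamma>)"
    using \<open>p \<noteq> 0\<close> by (simp add: \<gamma> K1_eq_affine aff[unfolded \<gamma>] Cst_mult_affine)
  have K2: "rat_comp (K2 \<gamma>) (fam \<beta> \<gamma>) = Some (K2 \<gamma> + 1)"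
    using \<open>p \<noteq> 0\<close> by (simp add: \<gamma> K2_eq_affine aff[unfolded \<gamma>] affine_plus_1)
  have J: "jacobian (K1 \<gamma>) (K2 \<gamma>) \<noteq> 0"
    using \<open>p \<noteq> 0\<close> by (simp add: \<gamma> K1_eq_affine K2_eq_affine jacobian_affine_nonzero)
  note nonconst = nonconstant_if_jacobian_nonzero[OF J]
  \<comment> \<open>A nonzero Jacobian determinant with some function is what shows that \<open>K\<^sub>1\<^sup>2\<close> is not constant.\<close>
  have "jacobian (K1 \<gamma> ^ 2) (K2 \<gamma> ^ 1) \<noteq> 0"
    using J by (intro jacobian_power_nonzero) simp_all
  then have W: "first_integral (fam \<beta> \<gamma>) (K1 \<gamma> ^ 2)"
    using rat_comp_eigen_power[OF K1, of 2] nonconstant_if_jacobian_nonzero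
    by (auto simp: first_integral_def)
  have "preserves_fibration (fam \<beta> \<gamma>) (K1 \<gamma>)" "preserves_fibration (fam \<beta> \<gamma>) (K2 \<gamma>)"
    using nonconst K1 K2 preserves_fibration_affineI[of "K1 \<gamma>" _ "- 1" 0]
      preserves_fibration_affineI[of "K2 \<gamma>" _ 1 1]
    by simp_all
  then show ?case
    using K1 K2 J W by (auto simp: generically_transverse_def integrable_map_def Cst_minus)
qed

end
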